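(* Let $r,d,m\ge 1$ be integers, let $\mathbf{k}_1,\dots,\mathbf{k}_m\in\mathbb{R}^r$ (keys) and $\mathbf{v}_1,\dots,\mathbf{v}_m\in\mathbb{R}^d$ (values) be fixed, and define $f:\mathbb{R}^r\to\mathbb{R}^d$ by $$f(\mathbf{p})=\frac{\sum_{j=1}^m e^{\langle \mathbf{p},\mathbf{k}_j\rangle}\,\mathbf{v}_j}{\sum_{k=1}^m e^{\langle \mathbf{p},\mathbf{k}_k\rangle}}.$$ Let $\mathbf{p}\in\mathbb{R}^r$ be fixed, and for $\mathbf{E}\in\mathbb{R}^r$ set $\varepsilon=\|\mathbf{E}\|$. Then $$\bigl\|f(\mathbf{p}+\mathbf{E})-f(\mathbf{p})\bigr\|=O(\varepsilon)\quad\text{as }\varepsilon\to 0,$$ i.e. there exist constants $C,\varepsilon_0>0$ (depending on $\mathbf{p}$, the keys and the values, but not on $\mathbf{E}$) such that $\|f(\mathbf{p}+\mathbf{E})-f(\mathbf{p})\|\le C\|\mathbf{E}\|$ for all $\mathbf{E}\in\mathbb{R}^r$ with $\|\mathbf{E}\|\le\varepsilon_0$.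
   Context: $\langle\cdot,\cdot\rangle$ is the Euclidean inner product and $\|\cdot\|$ the Euclidean norm. The function $f$ is the standard softmax attention output for query $\mathbf{p}$ with a finite set of keys and values; $\mathbf{p}$ plays the role of the exact value of a continuous query function at a mesh vertex and $\mathbf{p}+\mathbf{E}$ that of its computed discrete approximation. *)

theory Defs
  imports "HOL-Analysis.Analysis"
begin

definition softmax_attention ::
    "nat \<Rightarrow> (nat \<Rightarrow> real ^ 'r) \<Rightarrow> (nat \<Rightarrow> real ^ 'd) \<Rightarrow> real ^ 'r \<Rightarrow> real ^ 'd" where
  "softmax_attention m key val p =
     (\<Sum>j=1..m. exp (p \<bullet> key j) *\<^sub>R val j) /\<^sub>R (\<Sum>j=1..m. exp (p \<bullet> key j))"

end

theory Submission
  imports Defs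
begin

text \<open>Softmax attention is a smooth quotient whose denominator, a sum of exponentials, never
  vanishes, so it is differentiable at \<open>p\<close>
  (\<open>differentiable_softmax_attention\<close>). Near a point of differentiability the increment
  is a bounded linear map plus a remainder of smaller order, hence O(norm of the displacement)
  (\<open>differentiable_imp_pointwise_Lipschitz\<close>). Only the derivative at the one point
  \<open>p\<close> enters, so the constants may depend on \<open>p\<close>.\<close>

lemma differentiable_imp_pointwise_Lipschitz:
  fixes f :: "'a::real_normed_vector \<Rightarrow> 'b::real_normed_vector"
  assumes "f differentiable (at x)"
  shows "\<exists>C>0. \<exists>\<delta>>0. \<forall>h. norm h \<le> \<delta> \<longrightarrow> norm (f (x + h) - f x) \<le> C * norm h"
proof -
  obtain f' where "(f has_derivative f') (at x)"
    using assms unfolding differentiable_def by blast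
  then have lin: "bounded_linear f'"
    and approx: "\<forall>e>0. \<exists>d>0. \<forall>y. norm (y - x) < d \<longrightarrow>
      norm (f y - f x - f' (y - x)) \<le> e * norm (y - x)"
    unfolding has_derivative_at_alt by auto
  obtain K where K: "K > 0" "\<And>h. norm (f' h) \<le> norm h * K"
    using bounded_linear.pos_bounded[OF lin] by blast
  obtain d where d: "d > 0" "\<And>y. norm (y - x) < d \<Longrightarrow>
      norm (f y - f x - f' (y - x)) \<le> 1 * norm (y - x)"
    using approx zero_less_one by blast
  \<comment> \<open>\<open>K\<close> bounds the linear part; the 1 bounds the remainder, taking e =
    1 in the definition of the derivative. Halving \<open>d\<close> gives a closed ball inside the
    open one where that estimate holds.\<close>
  have "norm (f (x + h) - f x) \<le> (K + 1) * norm h" if "norm h \<le> d / 2" for h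
  proof -
    have "norm (f (x + h) - f x - f' h) \<le> norm h"
      using d(2)[of "x + h"] that d(1) by simp
    moreover have "norm (f (x + h) - f x) \<le> norm (f (x + h) - f x - f' h) + norm (f' h)"
      using norm_triangle_sub by (metis add.commute)
    ultimately show ?thesis
      using K(2)[of h] by (simp add: algebra_simps)
  qed
  then show ?thesis
    using K(1) d(1) by (intro exI[of _ "K + 1"] exI[of _ "d / 2"] conjI) auto
qed

lemma differentiable_softmax_attention:
  assumes "m \<ge> 1"
  shows "softmax_attention m key val differentiable (at p)"
proof -
  \<comment> \<open>The derivative stays schematic after \<open>exI\<close> and is assembled by the
    derivative rules.\<close>
  have exp_diff: "(\<lambda>q. exp (q \<bullet> key j)) differentiable (at p)" for j
    unfolding differentiable_def by (rule exI) (rule derivative_intros)+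
  \<comment> \<open>The index set is nonempty as \<open>m \<ge> 1\<close>. Positivity discharges the
    nonzero condition of \<open>differentiable_inverse\<close>, since \<open>/\<^sub>R\<close> is
    scaling by the inverse.\<close>
  have "(\<Sum>j=1..m. exp (p \<bullet> key j)) > 0"
    using assms by (intro sum_pos) auto
  then show ?thesis
    unfolding softmax_attention_def[abs_def]
    by (intro differentiable_scaleR differentiable_inverse differentiable_sum ballI exp_diff
          differentiable_const) auto
qed

theorem propositionA1:
  fixes m :: nat
    and key :: "nat \<Rightarrow> real ^ 'r"
    and val :: "nat \<Rightarrow> real ^ 'd"
    and p :: "real ^ 'r"
  assumes "m \<ge> 1"
  shows "\<exists>C>0. \<exists>\<epsilon>\<^sub>0>0. \<forall>E :: real ^ 'r. norm E \<le> \<epsilon>\<^sub>0 \<longrightarrow>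
           norm (softmax_attention m key val (p + E) - softmax_attention m key val p) \<le> C * norm E"
  by (intro differentiable_imp_pointwise_Lipschitz differentiable_softmax_attention assms)

end
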